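(* Let $m,n,r\in\mathbb{N}$ and let $\Gamma=\mathbb{Z}_m\times\mathbb{Z}_n\times\mathbb{Z}_r$. The subgroups of $\Gamma$ can be represented as follows. (i) Choose $a,b,c\in\mathbb{N}$ such that $a\mid m$, $b\mid n$, $c\mid r$. (ii) Put $A:=\gcd(a,n/b)$, $B:=\gcd(b,r/c)$, $C:=\gcd(a,r/c)$. (iii) Put $X:=\dfrac{ABC}{\gcd(a(r/c),\,ABC)}$. (iv) Let $s:=at/A$, where $t$ is an integer with $0\le t\le A-1$. (v) Let $v:=\dfrac{bX}{B\gcd(t,X)}\,w$, where $w$ is an integer with $0\le w\le B\gcd(t,X)/X-1$. (vi) Let $u_0$ be a solution of the linear congruence $(r/c)\,u\equiv rvs/(bc)\pmod a$ (one solution $u_0$ being fixed for each choice of $(a,b,c,t,w)$). (vii) Let $u:=u_0+az/C$, where $z$ is an integer with $0\le z\le C-1$. (viii) Put $$U_{a,b,c,t,w,z}:=\langle (a,0,0),(s,b,0),(u,v,c)\rangle$$ $$=\{(ia+js+ku,\ jb+kv,\ kc): 0\le i\le m/a-1,\ 0\le j\le n/b-1,\ 0\le k\le r/c-1\}.$$ Then $U_{a,b,c,t,w,z}$ is a subgroup of $\Gamma$ of order $mnr/(abc)$. Moreover, the map $(a,b,c,t,w,z)\mapsto U_{a,b,c,t,w,z}$ is a bijection between the set of sextuples $(a,b,c,t,w,z)$ satisfying the conditions (i)–(viii) and the set of subgroups of $\Gamma$.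
   Context: $\mathbb{N}=\{1,2,\ldots\}$. $\mathbb{Z}_m$ is the additive group of residue classes modulo $m$; integer tuples denote the corresponding elements of $\mathbb{Z}_m\times\mathbb{Z}_n\times\mathbb{Z}_r$, each coordinate being reduced modulo $m$, $n$, $r$ respectively. $\langle\cdots\rangle$ denotes the subgroup generated by the listed elements. By convention $\gcd(0,X)=X$. *)

theory Defs
  imports "HOL-Algebra.Elementary_Groups" "HOL-Number_Theory.Cong"
begin

definition Gam :: "nat \<Rightarrow> nat \<Rightarrow> nat \<Rightarrow> (int \<times> int \<times> int) monoid" where
  "Gam m n r = integer_mod_group m \<times>\<times> integer_mod_group n \<times>\<times> integer_mod_group r"

text \<open>\<open>integer_mod_group m\<close> has carrier \<open>{0..<m}\<close> for \<open>m > 0\<close>, so the class of an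
  integer is its remainder.\<close>

definition res :: "nat \<Rightarrow> nat \<Rightarrow> nat \<Rightarrow> int \<times> int \<times> int \<Rightarrow> int \<times> int \<times> int" where
  "res m n r = (\<lambda>(x, y, z). (x mod int m, y mod int n, z mod int r))"

definition A_of :: "nat \<Rightarrow> nat \<Rightarrow> nat \<Rightarrow> nat" where
  "A_of n a b = gcd a (n div b)"

definition B_of :: "nat \<Rightarrow> nat \<Rightarrow> nat \<Rightarrow> nat" where
  "B_of r b c = gcd b (r div c)"

definition C_of :: "nat \<Rightarrow> nat \<Rightarrow> nat \<Rightarrow> nat" where
  "C_of r a c = gcd a (r div c)"

definition X_of :: "nat \<Rightarrow> nat \<Rightarrow> nat \<Rightarrow> nat \<Rightarrow> nat \<Rightarrow> nat" where
  "X_of n r a b c =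
     (let P = A_of n a b * B_of r b c * C_of r a c in P div gcd (a * (r div c)) P)"

text \<open>All divisions \<open>div\<close> below are exact on admissible parameters; for those where this
  is not immediate see \<open>w_bound_exact\<close>, \<open>v_exact\<close>, \<open>rhs_exact\<close>.\<close>

definition s_of :: "nat \<Rightarrow> nat \<Rightarrow> nat \<Rightarrow> nat \<Rightarrow> nat" where
  "s_of n a b t = a * t div A_of n a b"

definition v_of :: "nat \<Rightarrow> nat \<Rightarrow> nat \<Rightarrow> nat \<Rightarrow> nat \<Rightarrow> nat \<Rightarrow> nat \<Rightarrow> nat" where
  "v_of n r a b c t w =
     b * X_of n r a b c div (B_of r b c * gcd t (X_of n r a b c)) * w"

definition quintuples :: "nat \<Rightarrow> nat \<Rightarrow> nat \<Rightarrow> (nat \<times> nat \<times> nat \<times> nat \<times> nat) set" where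
  "quintuples m n r = {(a, b, c, t, w).
     a > 0 \<and> b > 0 \<and> c > 0 \<and> a dvd m \<and> b dvd n \<and> c dvd r \<and>
     t < A_of n a b \<and>
     w < B_of r b c * gcd t (X_of n r a b c) div X_of n r a b c}"

definition sextuples :: "nat \<Rightarrow> nat \<Rightarrow> nat \<Rightarrow> (nat \<times> nat \<times> nat \<times> nat \<times> nat \<times> nat) set" where
  "sextuples m n r = {(a, b, c, t, w, z).
     (a, b, c, t, w) \<in> quintuples m n r \<and> z < C_of r a c}"

definition solves :: "nat \<Rightarrow> nat \<Rightarrow> nat \<Rightarrow> nat \<Rightarrow> nat \<Rightarrow> nat \<Rightarrow> nat \<Rightarrow> int \<Rightarrow> bool" where
  "solves n r a b c t w u \<longleftrightarrow>
     [int (r div c) * u = int (r * v_of n r a b c t w * s_of n a b t div (b * c))] (mod int a)"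

text \<open>A choice of one fixed solution \<open>u\<^sub>0\<close> for each admissible quintuple \<open>(a, b, c, t, w)\<close>.\<close>

definition solution_choice ::
    "nat \<Rightarrow> nat \<Rightarrow> nat \<Rightarrow> (nat \<Rightarrow> nat \<Rightarrow> nat \<Rightarrow> nat \<Rightarrow> nat \<Rightarrow> int) \<Rightarrow> bool" where
  "solution_choice m n r u0 \<longleftrightarrow>
     (\<forall>(a, b, c, t, w) \<in> quintuples m n r. solves n r a b c t w (u0 a b c t w))"

definition u_of :: "nat \<Rightarrow> (nat \<Rightarrow> nat \<Rightarrow> nat \<Rightarrow> nat \<Rightarrow> nat \<Rightarrow> int)
    \<Rightarrow> nat \<Rightarrow> nat \<Rightarrow> nat \<Rightarrow> nat \<Rightarrow> nat \<Rightarrow> nat \<Rightarrow> int" where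
  "u_of r u0 a b c t w z = u0 a b c t w + int (a * z div C_of r a c)"

definition U_sub :: "nat \<Rightarrow> nat \<Rightarrow> nat \<Rightarrow> (nat \<Rightarrow> nat \<Rightarrow> nat \<Rightarrow> nat \<Rightarrow> nat \<Rightarrow> int)
    \<Rightarrow> nat \<Rightarrow> nat \<Rightarrow> nat \<Rightarrow> nat \<Rightarrow> nat \<Rightarrow> nat \<Rightarrow> (int \<times> int \<times> int) set" where
  "U_sub m n r u0 a b c t w z = generate (Gam m n r)
     {res m n r (int a, 0, 0),
      res m n r (int (s_of n a b t), int b, 0),
      res m n r (u_of r u0 a b c t w z, int (v_of n r a b c t w), int c)}"

definition U_elems :: "nat \<Rightarrow> nat \<Rightarrow> nat \<Rightarrow> (nat \<Rightarrow> nat \<Rightarrow> nat \<Rightarrow> nat \<Rightarrow> nat \<Rightarrow> int)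
    \<Rightarrow> nat \<Rightarrow> nat \<Rightarrow> nat \<Rightarrow> nat \<Rightarrow> nat \<Rightarrow> nat \<Rightarrow> (int \<times> int \<times> int) set" where
  "U_elems m n r u0 a b c t w z =
     {res m n r (int i * int a + int j * int (s_of n a b t) + int k * u_of r u0 a b c t w z,
                 int j * int b + int k * int (v_of n r a b c t w),
                 int k * int c) | i j k.
        i < m div a \<and> j < n div b \<and> k < r div c}"

lemma AC_dvd: "A_of n a b * C_of r a c dvd a * (r div c)"
  unfolding A_of_def C_of_def by (intro mult_dvd_mono) auto

lemma X_dvd_B:
  assumes "a > 0" "b > 0"
  shows "X_of n r a b c dvd B_of r b c"
proof -
  define A B C where "A = A_of n a b" and "B = B_of r b c" and "C = C_of r a c"
  define g where "g = gcd (a * (r div c)) (A * B * C)"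
  have pos: "A > 0" "B > 0" "C > 0"
    using assms by (auto simp: A_def B_def C_def A_of_def B_of_def C_of_def)
  have "A * C dvd A * B * C"
    by (rule dvdI[where k = B]) (simp only: ac_simps)
  hence "A * C dvd g"
    unfolding g_def using AC_dvd[of n a b r c] by (simp add: A_def C_def)
  then obtain k where k: "g = A * C * k" by (rule dvdE)
  have "g dvd A * B * C" unfolding g_def by simp
  then obtain l where l: "A * B * C = g * l" by (rule dvdE)
  have "g > 0" unfolding g_def using pos by simp
  have "(A * C) * B = (A * C) * (k * l)"
    using l unfolding k by (simp only: ac_simps)
  hence "B = k * l" using pos by simp
  moreover have "X_of n r a b c = l"
  proof -
    have "X_of n r a b c = A * B * C div g"
      by (simp only: X_of_def Let_def A_def B_def C_def g_def)
    thus ?thesis using \<open>g > 0\<close> by (simp add: l)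
  qed
  ultimately show ?thesis by (simp add: B_def)
qed

lemma w_bound_exact:
  assumes "a > 0" "b > 0"
  shows "X_of n r a b c dvd B_of r b c * gcd t (X_of n r a b c)"
  using X_dvd_B[OF assms] by (rule dvd_mult2)

lemma v_exact: "B_of r b c * gcd t (X_of n r a b c) dvd b * X_of n r a b c"
  unfolding B_of_def by (intro mult_dvd_mono) auto

lemma rhs_exact:
  assumes "a > 0" "b > 0" "c dvd r"
  shows "b * c dvd r * v_of n r a b c t w * s_of n a b t"
proof -
  define B X where "B = B_of r b c" and "X = X_of n r a b c"
  define g where "g = gcd t X"
  have "B > 0" using assms by (simp add: B_def B_of_def)
  moreover have "X dvd B" using X_dvd_B[OF assms(1,2)] by (simp add: B_def X_def)
  ultimately have "X > 0" by (auto intro: Nat.gr0I)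
  have "g dvd X" "B dvd b" "B dvd r div c"
    by (simp_all add: g_def B_def B_of_def)
  then obtain k l q where k: "X = g * k" and l: "b = B * l" and q: "r div c = B * q"
    by (auto elim!: dvdE)
  have "B * g > 0" using \<open>B > 0\<close> \<open>X > 0\<close> k by auto
  have "b * X = (B * g) * (l * k)"
    unfolding k l by (simp only: ac_simps)
  hence "b * X div (B * g) = l * k"
    using \<open>B * g > 0\<close> by simp
  hence v: "v_of n r a b c t w = l * k * w"
    unfolding v_of_def B_def[symmetric] X_def[symmetric] g_def[symmetric] by simp
  have r: "r = B * q * c" using dvd_div_mult_self[OF assms(3)] q by simp
  have "r * (l * k * w) * s_of n a b t = (b * c) * (q * k * w * s_of n a b t)"
    unfolding l by (subst r) (simp only: ac_simps)
  thus ?thesis unfolding v by (rule dvdI)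
qed

end

theory Submission
  imports Defs "HOL-Library.Product_Plus"
begin

text \<open>Taking preimages under reduction \<open>res\<close> identifies the subgroups of
\<open>\<int>\<^sub>m \<times> \<int>\<^sub>n \<times> \<int>\<^sub>r\<close> with the additive subgroups of \<open>\<int>\<^sup>3\<close> that contain the three period vectors
\<open>(m, 0, 0)\<close>, \<open>(0, n, 0)\<close>, \<open>(0, 0, r)\<close>. Such a lattice has a basis
\<open>(a, 0, 0)\<close>, \<open>(s, b, 0)\<close>, \<open>(u, v, c)\<close> in Hermite normal form, and this basis is unique once
\<open>s\<close> is reduced modulo \<open>a\<close>, \<open>v\<close> modulo \<open>b\<close> and \<open>u\<close> is read modulo \<open>a\<close>
(\<open>hermite_normal_form_exists\<close>, \<open>hermite_lattice_unique\<close>).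

The theorem therefore amounts to saying which normal forms contain the periods. Solving
triangularly for the coefficients of the period vectors
(\<open>contains_periods_hermite_lattice_iff\<close>) gives \<open>a dvd m\<close>, \<open>b dvd n\<close>, \<open>c dvd r\<close> together with
the conditions \<open>a dvd (n/b) s\<close>, \<open>b dvd (r/c) v\<close> and \<open>(r/c) u \<equiv> ((r/c) v / b) s\<close> modulo \<open>a\<close>.
All of them are settled by the single fact that \<open>d dvd q x\<close> means \<open>d / gcd d q dvd x\<close>
(\<open>dvd_mult_iff_div_gcd_dvd\<close>): the first yields \<open>s = (a/A) t\<close>, the second \<open>v = (b/B) y\<close>; the
last is solvable in \<open>u\<close> iff \<open>C\<close> divides its right-hand side \<open>(r/c)(y/B)(a/A) t\<close>, that is, iff
\<open>A B C dvd a (r/c) (y t)\<close>, which is \<open>X dvd y t\<close> by the same fact, and \<open>X / gcd t X dvd y\<close> by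
using it once more. Hence \<open>y\<close> is \<open>X / gcd t X\<close> times a free parameter \<open>w\<close>. Finally two solutions
\<open>u\<close> differ by a multiple of \<open>a/C\<close>, which brings in \<open>z\<close>.

For the order of the subgroup, the period relations reduce the coefficients of a lattice vector
one at a time into the box \<open>i < m/a\<close>, \<open>j < n/b\<close>, \<open>k < r/c\<close>, on which reduction is injective
(\<open>res_hermite_lattice_box\<close>).\<close>

section \<open>Additive subgroups of \<open>\<int>\<close> and \<open>\<int>\<^sup>3\<close>\<close>

definition add_subgroup :: "'a::ab_group_add set \<Rightarrow> bool" where
  "add_subgroup P \<longleftrightarrow> 0 \<in> P \<and> (\<forall>p\<in>P. \<forall>q\<in>P. p - q \<in> P)"

lemma add_subgroup_diff:
  "add_subgroup P \<Longrightarrow> p \<in> P \<Longrightarrow> q \<in> P \<Longrightarrow> p - q \<in> P"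
  unfolding add_subgroup_def by blast

lemma add_subgroup_add:
  assumes "add_subgroup P" "p \<in> P" "q \<in> P"
  shows "p + q \<in> P"
proof -
  have "0 - q \<in> P" using assms unfolding add_subgroup_def by blast
  with assms have "p - (0 - q) \<in> P" by (blast intro: add_subgroup_diff)
  thus ?thesis by simp
qed

lemma add_subgroup_int_mult:
  fixes Q :: "int set"
  assumes "add_subgroup Q" "x \<in> Q"
  shows "k * x \<in> Q"
proof (induction k rule: int_induct[where k = 0])
  case base
  show ?case using assms by (simp add: add_subgroup_def)
next
  case (step1 i)
  thus ?case using add_subgroup_add[OF assms(1) _ assms(2), of "i * x"]
    by (simp add: algebra_simps)
next
  case (step2 i)
  thus ?case using add_subgroup_diff[OF assms(1) _ assms(2), of "i * x"]
    by (simp add: algebra_simps)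
qed

lemma add_subgroup_triple_mult:
  fixes P :: "(int \<times> int \<times> int) set"
  assumes "add_subgroup P" "(x, y, z) \<in> P"
  shows "(k * x, k * y, k * z) \<in> P"
proof (induction k rule: int_induct[where k = 0])
  case base
  show ?case using assms by (simp add: add_subgroup_def zero_prod_def)
next
  case (step1 i)
  thus ?case using add_subgroup_add[OF assms(1) _ assms(2), of "(i * x, i * y, i * z)"]
    by (simp add: algebra_simps)
next
  case (step2 i)
  thus ?case using add_subgroup_diff[OF assms(1) _ assms(2), of "(i * x, i * y, i * z)"]
    by (simp add: algebra_simps)
qed

text \<open>The generator is the least positive element.\<close>

lemma add_subgroup_int_principal:
  fixes Q :: "int set"
  assumes Q: "add_subgroup Q" and x: "int x \<in> Q" "x > 0"
  obtains d :: nat where "d > 0" "\<And>y. y \<in> Q \<longleftrightarrow> int d dvd y"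
proof -
  define d where "d = (LEAST d. d > 0 \<and> int d \<in> Q)"
  have d: "d > 0 \<and> int d \<in> Q"
    unfolding d_def by (rule LeastI[of _ x]) (use x in simp)
  have minimal: "d \<le> e" if "e > 0" "int e \<in> Q" for e
    unfolding d_def by (rule Least_le) (use that in simp)
  have "int d dvd y" if y: "y \<in> Q" for y
  proof (rule ccontr)
    assume "\<not> int d dvd y"
    hence "y mod int d \<noteq> 0" by (simp only: dvd_eq_mod_eq_0 not_False_eq_True)
    moreover have nonneg: "y mod int d \<ge> 0" using d by simp
    ultimately have "y mod int d > 0" by linarith
    moreover have "y mod int d \<in> Q"
      using add_subgroup_diff[OF Q y add_subgroup_int_mult[OF Q, of "int d" "y div int d"]] d
      by (simp add: minus_div_mult_eq_mod)
    ultimately have "d \<le> nat (y mod int d)" by (intro minimal) auto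
    hence "int d \<le> y mod int d" using nonneg by (simp add: le_nat_iff)
    moreover have "y mod int d < int d" using d by simp
    ultimately show False by linarith
  qed
  moreover have "y \<in> Q" if "int d dvd y" for y
    using that add_subgroup_int_mult[OF Q, of "int d"] d
    by (auto simp: dvd_def mult.commute)
  ultimately show ?thesis using d that by blast
qed

section \<open>Lattices in Hermite normal form\<close>

text \<open>The lattice spanned by the rows of a lower triangular matrix. The entry \<open>u\<close> stays an integer,
without any reduction, because the chosen solutions of the congruence for it are arbitrary
integers.\<close>

definition hermite_lattice ::
    "nat \<Rightarrow> nat \<Rightarrow> nat \<Rightarrow> nat \<Rightarrow> nat \<Rightarrow> int \<Rightarrow> (int \<times> int \<times> int) set" where
  "hermite_lattice a b c s v u =
     {(i * int a + j * int s + k * u, j * int b + k * int v, k * int c) | i j k. True}"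

lemma mem_hermite_lattice:
  "(x, y, z) \<in> hermite_lattice a b c s v u \<longleftrightarrow>
     (\<exists>i j k. x = i * int a + j * int s + k * u \<and> y = j * int b + k * int v \<and> z = k * int c)"
  unfolding hermite_lattice_def by simp

lemma hermite_lattice_generators:
  "(int a, 0, 0) \<in> hermite_lattice a b c s v u"
  "(int s, int b, 0) \<in> hermite_lattice a b c s v u"
  "(u, int v, int c) \<in> hermite_lattice a b c s v u"
  unfolding mem_hermite_lattice
    apply (rule exI[of _ 1], rule exI[of _ 0], rule exI[of _ 0], simp)
   apply (rule exI[of _ 0], rule exI[of _ 1], rule exI[of _ 0], simp)
  apply (rule exI[of _ 0], rule exI[of _ 0], rule exI[of _ 1], simp)
  done

lemma add_subgroup_hermite_lattice: "add_subgroup (hermite_lattice a b c s v u)"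
proof -
  have "(0, 0, 0) \<in> hermite_lattice a b c s v u"
    unfolding mem_hermite_lattice by (intro exI[of _ 0]) simp
  moreover have "(i * int a + j * int s + k * u, j * int b + k * int v, k * int c) -
      (i' * int a + j' * int s + k' * u, j' * int b + k' * int v, k' * int c)
      \<in> hermite_lattice a b c s v u" for i j k i' j' k'
    unfolding diff_Pair mem_hermite_lattice
    by (rule exI[of _ "i - i'"], rule exI[of _ "j - j'"], rule exI[of _ "k - k'"])
       (simp add: algebra_simps)
  ultimately show ?thesis
    unfolding add_subgroup_def zero_prod_def
    by (auto simp: hermite_lattice_def simp del: diff_Pair)
qed

lemma hermite_lattice_subset:
  assumes P: "add_subgroup P"
    and gens: "(int a, 0, 0) \<in> P" "(int s, int b, 0) \<in> P" "(u, int v, int c) \<in> P"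
  shows "hermite_lattice a b c s v u \<subseteq> P"
proof -
  have "(i * int a + j * int s + k * u, j * int b + k * int v, k * int c) \<in> P" for i j k
    using add_subgroup_add[OF P add_subgroup_add[OF P
        add_subgroup_triple_mult[OF P gens(1), of i]
        add_subgroup_triple_mult[OF P gens(2), of j]]
        add_subgroup_triple_mult[OF P gens(3), of k]]
    by simp
  thus ?thesis unfolding hermite_lattice_def by blast
qed

text \<open>Vectors of a lattice with vanishing last coordinates have vanishing last coefficients, so the
diagonal is determined from the bottom up. Only the residue class of \<open>u\<close> is determined, since
adding \<open>(a, 0, 0)\<close> to the last generator changes \<open>u\<close> alone.\<close>

lemma hermite_lattice_unique:
  assumes eq: "hermite_lattice a b c s v u = hermite_lattice a' b' c' s' v' u'"
    and pos: "a > 0" "b > 0" "c > 0" "a' > 0" "b' > 0" "c' > 0"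
    and reduced: "s < a" "s' < a'" "v < b" "v' < b'"
  shows "a = a'" "b = b'" "c = c'" "s = s'" "v = v'" "[u = u'] (mod int a)"
proof -
  \<comment> \<open>Each diagonal entry is recovered by mutual divisibility, for which the argument
     is stated symmetrically in the two lattices.\<close>
  have c_dvd: "z dvd y" if "hermite_lattice x1 x2 y x3 x4 x5 = hermite_lattice y1 y2 z y3 y4 y5"
    for x1 x2 x3 x4 x5 y1 y2 y3 y4 y5 y z
  proof -
    have "(x5, int x4, int y) \<in> hermite_lattice y1 y2 z y3 y4 y5"
      using hermite_lattice_generators(3) that by blast
    then obtain j where "int y = j * int z" using pos by (auto simp: mem_hermite_lattice)
    thus ?thesis by (metis dvd_triv_right int_dvd_int_iff)
  qed
  show c: "c = c'" using c_dvd[OF eq] c_dvd[OF eq[symmetric]] by (simp add: dvd_antisym)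
  have b_dvd: "z dvd y" if "hermite_lattice x1 y c x3 x4 x5 = hermite_lattice y1 z c y3 y4 y5"
    for x1 x3 x4 x5 y1 y3 y4 y5 y z
  proof -
    have "(int x3, int y, 0) \<in> hermite_lattice y1 z c y3 y4 y5"
      using hermite_lattice_generators(2) that by blast
    then obtain j where "int y = j * int z" using pos by (auto simp: mem_hermite_lattice)
    thus ?thesis by (metis dvd_triv_right int_dvd_int_iff)
  qed
  show b: "b = b'"
    using b_dvd eq eq[symmetric] unfolding c by (meson dvd_antisym)
  have a_dvd: "z dvd y" if "hermite_lattice y b c x3 x4 x5 = hermite_lattice z b c y3 y4 y5"
    for x3 x4 x5 y3 y4 y5 y z
  proof -
    have "(int y, 0, 0) \<in> hermite_lattice z b c y3 y4 y5"
      using hermite_lattice_generators(1) that by blast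
    then obtain j where "int y = j * int z" using pos by (auto simp: mem_hermite_lattice)
    thus ?thesis by (metis dvd_triv_right int_dvd_int_iff)
  qed
  show a: "a = a'"
    using a_dvd eq eq[symmetric] unfolding c b by (meson dvd_antisym)
  have "(int s, int b, 0) \<in> hermite_lattice a b c s' v' u'"
    using hermite_lattice_generators(2)[of s b a c v u] eq a b c by simp
  then obtain i where "int s = i * int a + int s'"
    using pos by (auto simp: mem_hermite_lattice)
  hence "[int s = int s'] (mod int a)"
    by (simp add: cong_def)
  thus s: "s = s'" using reduced a by (simp add: cong_def)
  have "(u, int v, int c) \<in> hermite_lattice a b c s' v' u'"
    using hermite_lattice_generators(3)[of u v c a b s] eq a b c by simp
  then obtain i j where ij: "u = i * int a + j * int s' + u'" "int v = j * int b + int v'"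
    using pos by (auto simp: mem_hermite_lattice)
  have "[int v = int v'] (mod int b)" using ij(2) by (simp add: cong_def)
  thus v: "v = v'" using reduced b by (simp add: cong_def)
  hence "j = 0" using ij(2) pos by simp
  thus "[u = u'] (mod int a)" using ij(1) by (simp add: cong_def)
qed

text \<open>The choice of \<open>u\<close> within its class modulo \<open>a\<close> is immaterial: the generators differ by a
multiple of \<open>(a, 0, 0)\<close>.\<close>

lemma hermite_lattice_cong:
  assumes "[u = u'] (mod int a)"
  shows "hermite_lattice a b c s v u = hermite_lattice a b c s v u'"
proof -
  have sub: "hermite_lattice a b c s v u \<subseteq> hermite_lattice a b c s v u'"
    if "[u = u'] (mod int a)" for u u'
  proof (rule hermite_lattice_subset[OF add_subgroup_hermite_lattice])
    obtain i where "u - u' = int a * i" using \<open>[u = u'] (mod int a)\<close> by (auto simp: cong_iff_dvd_diff)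
    hence "u = i * int a + 0 * int s + 1 * u'" by (simp add: algebra_simps)
    thus "(u, int v, int c) \<in> hermite_lattice a b c s v u'"
      unfolding mem_hermite_lattice by (intro exI[of _ i] exI[of _ 0] exI[of _ 1]) simp
  qed (rule hermite_lattice_generators)+
  show ?thesis using sub[OF assms] sub[OF cong_sym[OF assms]] by blast
qed

definition contains_periods :: "nat \<Rightarrow> nat \<Rightarrow> nat \<Rightarrow> (int \<times> int \<times> int) set \<Rightarrow> bool" where
  "contains_periods m n r P \<longleftrightarrow>
     (int m, 0, 0) \<in> P \<and> (0, int n, 0) \<in> P \<and> (0, 0, int r) \<in> P"

text \<open>The diagonal entries generate three subgroups of \<open>\<int>\<close>: the first coordinates of the vectors
\<open>(x, 0, 0)\<close> in \<open>P\<close>, the second coordinates of the vectors \<open>(x, y, 0)\<close>, and the third coordinates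
of all vectors. The periods make these subgroups nonzero. Subtracting multiples of the generators
found so far both reduces \<open>s\<close> and \<open>v\<close> and eliminates the coordinates of any vector of \<open>P\<close> from the
last to the first.\<close>

lemma hermite_normal_form_exists:
  assumes P: "add_subgroup P" and per: "contains_periods m n r P"
    and pos: "m > 0" "n > 0" "r > 0"
  obtains a b c s v u where "a > 0" "b > 0" "c > 0" "s < a" "v < b"
    "P = hermite_lattice a b c s v u"
proof -
  have zero: "(0, 0, 0) \<in> P" using P by (simp add: add_subgroup_def zero_prod_def)
  define Q1 where "Q1 = {x. (x, 0, 0) \<in> P}"
  define Q2 where "Q2 = {y. \<exists>x. (x, y, 0) \<in> P}"
  define Q3 where "Q3 = {z. \<exists>x y. (x, y, z) \<in> P}"
  have diff: "(x - x', y - y', z - z') \<in> P" if "(x, y, z) \<in> P" "(x', y', z') \<in> P"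
    for x y z x' y' z'
    using add_subgroup_diff[OF P that] by simp
  have Q: "add_subgroup Q1" "add_subgroup Q2" "add_subgroup Q3"
  proof -
    show "add_subgroup Q1"
      using zero diff[of _ 0 0 _ 0 0] by (auto simp: add_subgroup_def Q1_def)
    show "add_subgroup Q2"
      using zero diff[of _ _ 0 _ _ 0] by (fastforce simp: add_subgroup_def Q2_def)
    show "add_subgroup Q3"
      using zero by (auto simp: add_subgroup_def Q3_def dest: diff)
  qed
  have per_mem: "int m \<in> Q1" "int n \<in> Q2" "int r \<in> Q3"
    using per unfolding Q1_def Q2_def Q3_def contains_periods_def by blast+
  obtain a where a: "a > 0" "\<And>y. y \<in> Q1 \<longleftrightarrow> int a dvd y"
    using add_subgroup_int_principal[OF Q(1) per_mem(1) pos(1)] by metis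
  obtain b where b: "b > 0" "\<And>y. y \<in> Q2 \<longleftrightarrow> int b dvd y"
    using add_subgroup_int_principal[OF Q(2) per_mem(2) pos(2)] by metis
  obtain c where c: "c > 0" "\<And>y. y \<in> Q3 \<longleftrightarrow> int c dvd y"
    using add_subgroup_int_principal[OF Q(3) per_mem(3) pos(3)] by metis
  have gen1: "(int a, 0, 0) \<in> P" using a(2)[of "int a"] by (simp add: Q1_def)
  obtain s0 where s0: "(s0, int b, 0) \<in> P" using b(2)[of "int b"] by (auto simp: Q2_def)
  obtain u v0 where v0: "(u, v0, int c) \<in> P" using c(2)[of "int c"] by (auto simp: Q3_def)
  define s where "s = nat (s0 mod int a)"
  have s_int: "int s = s0 - s0 div int a * int a"
    using a(1) by (simp add: s_def minus_div_mult_eq_mod)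
  have gen2: "(int s, int b, 0) \<in> P"
    using diff[OF s0 add_subgroup_triple_mult[OF P gen1, of "s0 div int a"]] s_int by simp
  define v where "v = nat (v0 mod int b)"
  have v_int: "int v = v0 - v0 div int b * int b"
    using b(1) by (simp add: v_def minus_div_mult_eq_mod)
  define u1 where "u1 = u - v0 div int b * int s"
  have gen3: "(u1, int v, int c) \<in> P"
    using diff[OF v0 add_subgroup_triple_mult[OF P gen2, of "v0 div int b"]] v_int
    by (simp add: u1_def)
  have "P \<subseteq> hermite_lattice a b c s v u1"
  proof
    fix p assume "p \<in> P"
    moreover obtain x y z where p: "p = (x, y, z)" by (cases p) auto
    ultimately have xyz: "(x, y, z) \<in> P" by simp
    hence "z \<in> Q3" by (auto simp: Q3_def)
    then obtain k where k: "z = k * int c" using c(2) by (auto simp: dvd_def mult.commute)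
    have 1: "(x - k * u1, y - k * int v, 0) \<in> P"
      using diff[OF xyz add_subgroup_triple_mult[OF P gen3, of k]] k by simp
    hence "y - k * int v \<in> Q2" by (auto simp: Q2_def)
    then obtain j where j: "y - k * int v = j * int b"
      using b(2) by (auto simp: dvd_def mult.commute)
    have "(x - k * u1 - j * int s, 0, 0) \<in> P"
      using diff[OF 1 add_subgroup_triple_mult[OF P gen2, of j]] j by simp
    hence "x - k * u1 - j * int s \<in> Q1" by (auto simp: Q1_def)
    then obtain i where i: "x - k * u1 - j * int s = i * int a"
      using a(2) by (auto simp: dvd_def mult.commute)
    show "p \<in> hermite_lattice a b c s v u1"
      unfolding p mem_hermite_lattice
      by (rule exI[of _ i], rule exI[of _ j], rule exI[of _ k])
         (use i j k in \<open>simp add: algebra_simps\<close>)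
  qed
  hence "P = hermite_lattice a b c s v u1"
    using hermite_lattice_subset[OF P gen1 gen2 gen3] by blast
  moreover have "s < a" "v < b"
    using a(1) b(1) by (simp_all add: s_def v_def nat_less_iff)
  ultimately show ?thesis using that a(1) b(1) c(1) by blast
qed

text \<open>The coefficients of a period vector in the triangular basis are forced: for \<open>(0, 0, r)\<close> they are
\<open>k = r/c\<close>, then \<open>j = - k v / b\<close>, and the first coordinate leaves the congruence on \<open>u\<close> as the
condition that \<open>i\<close> be an integer.\<close>

lemma contains_periods_hermite_lattice_iff:
  assumes pos: "a > 0" "b > 0" "c > 0"
  shows "contains_periods m n r (hermite_lattice a b c s v u) \<longleftrightarrow>
    a dvd m \<and> b dvd n \<and> c dvd r \<and> a dvd (n div b) * s \<and> b dvd (r div c) * v \<and>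
    [int (r div c) * u = int ((r div c) * v div b * s)] (mod int a)"
proof -
  have 1: "(int m, 0, 0) \<in> hermite_lattice a b c s v u \<longleftrightarrow> a dvd m"
  proof -
    have "(int m, 0, 0) \<in> hermite_lattice a b c s v u \<longleftrightarrow> (\<exists>i. int m = i * int a)"
      using pos by (auto simp: mem_hermite_lattice intro!: exI[of _ 0])
    also have "\<dots> \<longleftrightarrow> int a dvd int m" by (auto simp: dvd_def mult.commute)
    finally show ?thesis by simp
  qed
  have 2: "(0, int n, 0) \<in> hermite_lattice a b c s v u \<longleftrightarrow> b dvd n \<and> a dvd (n div b) * s"
  proof -
    have "(0, int n, 0) \<in> hermite_lattice a b c s v u \<longleftrightarrow>
        (\<exists>i j. 0 = i * int a + j * int s \<and> int n = j * int b)"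
      using pos by (auto simp: mem_hermite_lattice)
    also have "\<dots> \<longleftrightarrow> (\<exists>j. int n = j * int b \<and> int a dvd j * int s)"
    proof -
      have "(\<exists>i. 0 = i * int a + j * int s) \<longleftrightarrow> int a dvd j * int s" for j
      proof
        assume "\<exists>i. 0 = i * int a + j * int s"
        then obtain i where "0 = i * int a + j * int s" by blast
        hence "j * int s = int a * (- i)" by (simp add: algebra_simps)
        thus "int a dvd j * int s" by (rule dvdI)
      next
        assume "int a dvd j * int s"
        then obtain i where "j * int s = int a * i" by (rule dvdE)
        thus "\<exists>i. 0 = i * int a + j * int s" by (intro exI[of _ "- i"]) simp
      qed
      thus ?thesis by blast
    qed
    also have "\<dots> \<longleftrightarrow> int b dvd int n \<and> int a dvd int n div int b * int s"
      using pos by (auto simp: dvd_def mult.commute)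
    also have "\<dots> \<longleftrightarrow> b dvd n \<and> a dvd (n div b) * s"
      by (simp flip: zdiv_int of_nat_mult)
    finally show ?thesis .
  qed
  have 3: "(0, 0, int r) \<in> hermite_lattice a b c s v u \<longleftrightarrow> c dvd r \<and> b dvd (r div c) * v \<and>
    [int (r div c) * u = int ((r div c) * v div b * s)] (mod int a)" (is "?L \<longleftrightarrow> ?R")
  proof
    assume ?L
    then obtain i j k where ijk: "0 = i * int a + j * int s + k * u" "0 = j * int b + k * int v"
      "int r = k * int c" by (auto simp: mem_hermite_lattice)
    have "int c dvd int r" using ijk by simp
    hence cr: "c dvd r" by simp
    have "k = int r div int c" using ijk(3) pos by simp
    hence k: "k = int (r div c)" by (simp add: zdiv_int)
    have jb: "int ((r div c) * v) = (- j) * int b" using ijk(2) k by simp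
    hence "int b dvd int ((r div c) * v)" by (metis dvd_triv_right)
    hence bv: "b dvd (r div c) * v" using int_dvd_int_iff by blast
    have j: "int ((r div c) * v div b) = - j"
    proof -
      have "int ((r div c) * v div b) * int b = int ((r div c) * v)"
        using bv by (metis dvd_div_mult_self of_nat_mult)
      hence "int ((r div c) * v div b) * int b = (- j) * int b" using jb by (rule trans)
      thus ?thesis using pos by (simp only: mult_cancel_right) auto
    qed
    have "int (r div c) * u = int ((r div c) * v div b * s) + (- i) * int a"
      unfolding of_nat_mult[of _ s] j using ijk(1) k by (simp add: algebra_simps)
    hence "[int (r div c) * u = int ((r div c) * v div b * s)] (mod int a)"
      by (simp add: cong_iff_dvd_diff)
    thus ?R using cr bv by blast
  next
    assume R: ?R
    define k j where "k = int (r div c)" and "j = - int ((r div c) * v div b)"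
    obtain i where "int (r div c) * u - int ((r div c) * v div b * s) = int a * i"
      using R by (auto simp: cong_iff_dvd_diff elim: dvdE)
    hence i: "k * u + j * int s = int a * i" by (simp add: k_def j_def)
    have "int ((r div c) * v div b * b) = int ((r div c) * v)" using R by simp
    hence "j * int b = - (k * int v)" by (simp add: j_def k_def)
    moreover have "int (r div c * c) = int r" using R by simp
    hence "k * int c = int r" by (simp add: k_def)
    ultimately show ?L
      unfolding mem_hermite_lattice using i
      by (intro exI[of _ "- i"] exI[of _ j] exI[of _ k]) (simp add: algebra_simps)
  qed
  show ?thesis unfolding contains_periods_def 1 2 3 by blast
qed

section \<open>Subgroups of \<open>\<int>\<^sub>m \<times> \<int>\<^sub>n \<times> \<int>\<^sub>r\<close>\<close>

lemma group_Gam: "group (Gam m n r)"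
  unfolding Gam_def by (intro DirProd_group group_integer_mod_group)

lemma carrier_Gam:
  "m > 0 \<Longrightarrow> n > 0 \<Longrightarrow> r > 0 \<Longrightarrow>
   carrier (Gam m n r) = {0..<int m} \<times> {0..<int n} \<times> {0..<int r}"
  by (simp add: Gam_def carrier_integer_mod_group)

lemma one_Gam: "\<one>\<^bsub>Gam m n r\<^esub> = res m n r 0"
  by (simp add: Gam_def res_def zero_prod_def)

lemma res_in_carrier: "m > 0 \<Longrightarrow> n > 0 \<Longrightarrow> r > 0 \<Longrightarrow> res m n r p \<in> carrier (Gam m n r)"
  by (cases p) (simp add: carrier_Gam res_def)

lemma res_of_carrier:
  "m > 0 \<Longrightarrow> n > 0 \<Longrightarrow> r > 0 \<Longrightarrow> p \<in> carrier (Gam m n r) \<Longrightarrow> res m n r p = p"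
  by (cases p) (simp add: carrier_Gam res_def)

lemma mult_res: "res m n r p \<otimes>\<^bsub>Gam m n r\<^esub> res m n r q = res m n r (p + q)"
  by (cases p; cases q) (simp add: Gam_def res_def mod_add_eq)

lemma inv_res:
  assumes "m > 0" "n > 0" "r > 0"
  shows "inv\<^bsub>Gam m n r\<^esub> (res m n r p) = res m n r (- p)"
  by (rule group.inv_equality[OF group_Gam])
     (simp_all add: mult_res one_Gam res_in_carrier assms)

lemma res_eq_iff:
  "res m n r (x, y, z) = res m n r (x', y', z') \<longleftrightarrow>
     int m dvd x - x' \<and> int n dvd y - y' \<and> int r dvd z - z'"
  by (simp add: res_def mod_eq_dvd_iff)

lemma subgroup_res_image:
  assumes P: "add_subgroup P" and pos: "m > 0" "n > 0" "r > 0"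
  shows "subgroup (res m n r ` P) (Gam m n r)"
proof
  show "res m n r ` P \<subseteq> carrier (Gam m n r)" using pos by (auto intro: res_in_carrier)
  show "x \<otimes>\<^bsub>Gam m n r\<^esub> y \<in> res m n r ` P" if "x \<in> res m n r ` P" "y \<in> res m n r ` P" for x y
    using that add_subgroup_add[OF P] by (auto simp: mult_res)
  show one: "\<one>\<^bsub>Gam m n r\<^esub> \<in> res m n r ` P"
    using P by (auto simp: one_Gam add_subgroup_def)
  show "inv\<^bsub>Gam m n r\<^esub> x \<in> res m n r ` P" if x: "x \<in> res m n r ` P" for x
  proof -
    obtain p where p: "p \<in> P" "x = res m n r p" using x by blast
    have "0 - p \<in> P" using P p(1) unfolding add_subgroup_def by blast
    thus ?thesis using p(2) by (auto simp: inv_res[OF pos])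
  qed
qed

lemma res_preimage_of_subgroup:
  assumes H: "subgroup H (Gam m n r)" and pos: "m > 0" "n > 0" "r > 0"
  shows "add_subgroup (res m n r -` H)" "contains_periods m n r (res m n r -` H)"
    "res m n r ` (res m n r -` H) = H"
proof -
  have one: "res m n r 0 \<in> H" using subgroup.one_closed[OF H] by (simp add: one_Gam)
  have "res m n r (p - q) \<in> H" if "res m n r p \<in> H" "res m n r q \<in> H" for p q
    using subgroup.m_closed[OF H that(1) subgroup.m_inv_closed[OF H that(2)]]
    by (simp add: inv_res[OF pos] mult_res)
  thus "add_subgroup (res m n r -` H)" using one by (simp add: add_subgroup_def)
  have "res m n r (int m, 0, 0) = res m n r 0" "res m n r (0, int n, 0) = res m n r 0"
    "res m n r (0, 0, int r) = res m n r 0"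
    by (simp_all add: res_def zero_prod_def)
  thus "contains_periods m n r (res m n r -` H)" using one by (simp add: contains_periods_def)
  show "res m n r ` (res m n r -` H) = H"
  proof -
    have "x \<in> res m n r ` (res m n r -` H)" if "x \<in> H" for x
    proof
      show "x = res m n r x"
        using res_of_carrier[OF pos] subgroup.subset[OF H] that by fastforce
      thus "x \<in> res m n r -` H" using that by simp
    qed
    thus ?thesis by blast
  qed
qed

text \<open>The kernel of reduction is spanned by the period vectors, so a lattice that contains them is
saturated.\<close>

lemma res_preimage_image:
  assumes P: "add_subgroup P" and per: "contains_periods m n r P"
  shows "res m n r -` (res m n r ` P) = P"
proof -
  have "(x, y, z) \<in> P"
    if eq: "res m n r (x, y, z) = res m n r (x', y', z')" and mem: "(x', y', z') \<in> P"
    for x y z x' y' z'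
  proof -
    obtain i j k where ijk: "x - x' = int m * i" "y - y' = int n * j" "z - z' = int r * k"
      using eq by (auto simp: res_eq_iff elim!: dvdE)
    have "(x', y', z') + ((i * int m, i * 0, i * 0) + ((j * 0, j * int n, j * 0) + (k * 0, k * 0, k * int r))) \<in> P"
      by (intro add_subgroup_add[OF P] add_subgroup_triple_mult[OF P])
         (use mem per in \<open>simp_all add: contains_periods_def\<close>)
    moreover have "x = x' + i * int m" "y = y' + j * int n" "z = z' + k * int r"
      using ijk by (simp_all add: algebra_simps)
    ultimately show ?thesis by simp
  qed
  thus ?thesis by fastforce
qed

lemma generate_eq_res_hermite_lattice:
  assumes pos: "m > 0" "n > 0" "r > 0"
  shows "generate (Gam m n r)
      {res m n r (int a, 0, 0), res m n r (int s, int b, 0), res m n r (u, int v, int c)} =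
    res m n r ` hermite_lattice a b c s v u" (is "generate ?G ?K = ?R")
proof (rule group.generateI[OF group_Gam, symmetric])
  show "subgroup ?R ?G"
    by (intro subgroup_res_image add_subgroup_hermite_lattice pos)
  show "?K \<subseteq> ?R" using hermite_lattice_generators by auto
  fix K assume K: "subgroup K ?G" "?K \<subseteq> K"
  have "hermite_lattice a b c s v u \<subseteq> res m n r -` K"
    using K(2) by (intro hermite_lattice_subset res_preimage_of_subgroup(1)[OF K(1) pos]) auto
  thus "?R \<subseteq> K" by blast
qed

section \<open>Box representatives and the order of the subgroup\<close>

text \<open>With \<open>M = m/a\<close>, \<open>N = n/b\<close>, \<open>Q = r/c\<close>, the period conditions read
\<open>N s = a e\<close>, \<open>Q v = b f\<close>, \<open>Q u = f s + a g\<close>. They say what happens to a vector modulo the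
periods when \<open>Q\<close> is subtracted from \<open>k\<close>: then \<open>j\<close> grows by \<open>f\<close> and \<open>i\<close> by \<open>g\<close>;
subtracting \<open>N\<close> from \<open>j\<close> makes \<open>i\<close> grow by \<open>e\<close>. Injectivity on the box is read off from the
third coordinate, then the second, then the first.\<close>

lemma res_hermite_lattice_box:
  assumes pos: "a > 0" "b > 0" "c > 0" "m > 0" "n > 0" "r > 0"
    and per: "contains_periods m n r (hermite_lattice a b c s v u)"
  shows "res m n r ` hermite_lattice a b c s v u =
    {res m n r (int i * int a + int j * int s + int k * u, int j * int b + int k * int v, int k * int c) | i j k.
        i < m div a \<and> j < n div b \<and> k < r div c}" (is "?L = ?R")
    and "card (res m n r ` hermite_lattice a b c s v u) = m * n * r div (a * b * c)"
proof -
  define M N Q where "M = m div a" and "N = n div b" and "Q = r div c"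
  note per_iff = per[unfolded contains_periods_hermite_lattice_iff[OF pos(1,2,3)], folded N_def Q_def]
  have m: "m = a * M" and n: "n = b * N" and r: "r = c * Q"
    using per_iff by (simp_all add: M_def N_def Q_def)
  have MNQ: "M > 0" "N > 0" "Q > 0" using pos m n r by (auto intro: Nat.gr0I)
  obtain e where "N * s = a * e" using per_iff by (auto elim: dvdE)
  hence e: "int N * int s = int a * int e" by (metis of_nat_mult)
  define f where "f = Q * v div b"
  have "Q * v = b * f" using per_iff by (simp add: f_def)
  hence f: "int Q * int v = int b * int f" by (metis of_nat_mult)
  obtain g where "int Q * u - int (f * s) = int a * g"
    using per_iff by (auto simp: cong_iff_dvd_diff f_def elim: dvdE)
  hence g: "int Q * u = int f * int s + int a * g" by simp
  define F where "F = (\<lambda>(i, j, k). res m n r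
    (int i * int a + int j * int s + int k * u, int j * int b + int k * int v, int k * int c))"
  define box where "box = {..<M} \<times> {..<N} \<times> {..<Q}"
  have R: "?R = F ` box"
  proof -
    have "?R = {p. \<exists>i j k. p = F (i, j, k) \<and> (i, j, k) \<in> box}"
      unfolding F_def box_def M_def N_def Q_def by (intro Collect_cong ex_cong1) auto
    also have "\<dots> = F ` box" by force
    finally show ?thesis .
  qed
  have "F ` box \<subseteq> ?L"
    by (auto simp: F_def hermite_lattice_def)
  moreover have "?L \<subseteq> F ` box"
  proof -
    have "res m n r (i * int a + j * int s + k * u, j * int b + k * int v, k * int c) \<in> F ` box" for i j k
  proof -
    \<comment> \<open>Primed letters are reduced coefficients; \<open>j1\<close> and \<open>i1\<close> include the carries from the
       coefficients reduced before them.\<close>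
    define l where "l = k div int Q"
    define k' where "k' = nat (k mod int Q)"
    have k: "k = int k' + int Q * l" "k' < Q"
      using MNQ by (simp_all add: k'_def l_def nat_less_iff)
    define j1 where "j1 = j + l * int f"
    define h where "h = j1 div int N"
    define j' where "j' = nat (j1 mod int N)"
    have j: "j1 = int j' + int N * h" "j' < N"
      using MNQ by (simp_all add: j'_def h_def nat_less_iff)
    define i1 where "i1 = i + l * g + h * int e"
    define y where "y = i1 div int M"
    define i' where "i' = nat (i1 mod int M)"
    have i: "i1 = int i' + int M * y" "i' < M"
      using MNQ by (simp_all add: i'_def y_def nat_less_iff)
    have z: "k * int c - int k' * int c = int r * l"
      by (simp add: k r algebra_simps)
    have jj: "j = int j' + int N * h - l * int f" using j(1) by (simp add: j1_def)
    have "(j * int b + k * int v) - (int j' * int b + int k' * int v) =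
        int n * h + l * (int Q * int v - int b * int f)"
      by (simp add: k(1) jj n algebra_simps)
    hence y: "(j * int b + k * int v) - (int j' * int b + int k' * int v) = int n * h"
      by (simp add: f)
    have ii: "i = int i' + int M * y - l * g - h * int e" using i(1) by (simp add: i1_def)
    have "(i * int a + j * int s + k * u) - (int i' * int a + int j' * int s + int k' * u) =
        int m * y + h * (int N * int s - int a * int e) + l * (int Q * u - (int f * int s + int a * g))"
      by (simp add: k(1) jj ii m algebra_simps)
    hence x: "(i * int a + j * int s + k * u) - (int i' * int a + int j' * int s + int k' * u) = int m * y"
      by (simp add: e g)
    have "res m n r (i * int a + j * int s + k * u, j * int b + k * int v, k * int c) = F (i', j', k')"
      unfolding F_def prod.case res_eq_iff x y z by simp
    moreover have "(i', j', k') \<in> box" using i j k by (simp add: box_def)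
    ultimately show ?thesis by blast
  qed
    thus ?thesis unfolding hermite_lattice_def by blast
  qed
  ultimately have L: "?L = F ` box" by blast
  thus "?L = ?R" using R by simp
  have coeff: "x = x'" if "int (d * D) dvd (int x - int x') * int d" "x < D" "x' < D" "d > 0"
    for x x' d D :: nat
  proof -
    have "int D dvd int x - int x'" using that by simp
    hence "[x = x'] (mod D)" by (simp add: cong_iff_dvd_diff flip: cong_int_iff)
    thus ?thesis using that by (simp add: cong_def)
  qed
  have "inj_on F box"
  proof (rule inj_onI)
    fix p p' assume p: "p \<in> box" "p' \<in> box" and eq: "F p = F p'"
    obtain i j k i' j' k' where ijk: "p = (i, j, k)" "p' = (i', j', k')" by (metis prod_cases3)
    note dv = eq[unfolded ijk F_def prod.case res_eq_iff]
    have k: "k = k'" using dv p pos coeff[of c Q k k'] by (simp add: ijk box_def r left_diff_distrib)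
    have j: "j = j'" using dv p pos coeff[of b N j j'] by (simp add: k ijk box_def n left_diff_distrib)
    have i: "i = i'" using dv p pos coeff[of a M i i'] by (simp add: k j ijk box_def m left_diff_distrib)
    show "p = p'" by (simp add: ijk i j k)
  qed
  hence "card ?L = M * N * Q" unfolding L by (simp add: card_image box_def)
  moreover have "m * n * r = (M * N * Q) * (a * b * c)" by (simp add: m n r)
  ultimately show "card ?L = m * n * r div (a * b * c)" using pos by simp
qed

section \<open>Reduced solutions of linear congruences\<close>

lemma dvd_mult_iff_div_gcd_dvd:
  fixes d q x :: "'a::semiring_gcd"
  assumes "d \<noteq> 0"
  shows "d dvd q * x \<longleftrightarrow> d div gcd d q dvd x"
proof -
  define g where "g = gcd d q"
  have g: "g \<noteq> 0" using assms by (simp add: g_def)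
  then obtain d' q' where dq: "d = d' * g" "q = q' * g" "coprime d' q'"
    unfolding g_def by (metis gcd_coprime_exists)
  have "d dvd q * x \<longleftrightarrow> d' * g dvd (q' * x) * g" by (simp add: dq(1,2) ac_simps)
  also have "\<dots> \<longleftrightarrow> d' dvd q' * x" using g by simp
  also have "\<dots> \<longleftrightarrow> d' dvd x" by (rule coprime_dvd_mult_right_iff[OF dq(3)])
  also have "d' = d div g" unfolding dq(1) using g by simp
  finally show ?thesis unfolding g_def .
qed

lemma less_and_dvd_iff:
  fixes d N x :: nat
  assumes "d dvd N" "d > 0"
  shows "x < N \<and> d dvd x \<longleftrightarrow> (\<exists>y < N div d. x = d * y)"
  using assms by (auto elim!: dvdE)

text \<open>The residues modulo \<open>d\<close> annihilated by \<open>q\<close> are the \<open>gcd d q\<close> multiples of \<open>d / gcd d q\<close>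
below \<open>d\<close>. Both \<open>s\<close> and, before solvability is imposed, \<open>v\<close> range over such a set.\<close>

lemma reduced_annihilator_iff:
  fixes d q x :: nat
  assumes "d > 0"
  shows "x < d \<and> d dvd q * x \<longleftrightarrow> (\<exists>y < gcd d q. x = d div gcd d q * y)"
proof -
  obtain e where e: "d = gcd d q * e" by (rule dvdE[OF gcd_dvd1])
  hence "e > 0" using assms by (auto intro: Nat.gr0I)
  moreover have "d div gcd d q = e" using e assms by (metis gcd_pos_nat nonzero_mult_div_cancel_left less_not_refl)
  moreover have "d div e = gcd d q" using e \<open>e > 0\<close> by (metis less_not_refl nonzero_mult_div_cancel_right)
  ultimately show ?thesis
    using less_and_dvd_iff[of e d x] dvd_mult_iff_div_gcd_dvd[of d q x] e assms
    by (metis dvd_triv_right less_not_refl)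
qed

text \<open>The difference of two solutions is annihilated by \<open>q\<close> modulo \<open>a\<close>, so it is a multiple of
\<open>a / gcd a q\<close>, and the multiplier matters modulo \<open>gcd a q\<close> only.\<close>

lemma congruence_solutions_iff:
  fixes a q :: nat and R u u0 :: int
  assumes "a > 0" and u0: "[int q * u0 = R] (mod int a)"
  shows "[int q * u = R] (mod int a) \<longleftrightarrow>
    (\<exists>z < gcd a q. [u = u0 + int (a div gcd a q * z)] (mod int a))"
proof -
  define C e where "C = gcd a q" and "e = a div C"
  have a: "a = C * e" by (simp add: C_def e_def)
  hence pos: "C > 0" "e > 0" using assms(1) by (auto intro: Nat.gr0I)
  have "[int q * u = R] (mod int a) \<longleftrightarrow> [int q * u = int q * u0] (mod int a)"
    using u0 by (meson cong_sym cong_trans)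
  also have "\<dots> \<longleftrightarrow> int a dvd int q * (u - u0)"
    by (simp add: cong_iff_dvd_diff right_diff_distrib)
  also have "\<dots> \<longleftrightarrow> int e dvd u - u0"
    using assms(1) by (subst dvd_mult_iff_div_gcd_dvd) (simp_all add: e_def C_def zdiv_int)
  also have "\<dots> \<longleftrightarrow> (\<exists>z < C. [u = u0 + int (e * z)] (mod int a))"
  proof
    assume "int e dvd u - u0"
    then obtain y where y: "u - u0 = int e * y" by (rule dvdE)
    define z where "z = nat (y mod int C)"
    have z: "int z = y - int C * (y div int C)"
      using pos by (simp add: z_def minus_mult_div_eq_mod)
    have "u - (u0 + int (e * z)) = int a * (y div int C)"
      using y by (simp add: z a algebra_simps)
    hence "[u = u0 + int (e * z)] (mod int a)"
      by (simp add: cong_iff_dvd_diff)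
    moreover have "z < C" using pos by (simp add: z_def nat_less_iff)
    ultimately show "\<exists>z < C. [u = u0 + int (e * z)] (mod int a)" by blast
  next
    assume "\<exists>z < C. [u = u0 + int (e * z)] (mod int a)"
    then obtain z where "int a dvd u - (u0 + int (e * z))" by (auto simp: cong_iff_dvd_diff)
    hence "int e dvd u - (u0 + int (e * z))" using a by (metis dvd_mult_left dvd_trans dvd_triv_right int_dvd_int_iff)
    hence "int e dvd u - (u0 + int (e * z)) + int e * int z" by (intro dvd_add) simp_all
    thus "int e dvd u - u0" by simp
  qed
  finally show ?thesis by (simp add: C_def e_def)
qed

section \<open>Normal forms in terms of the parameters\<close>

text \<open>This is what \<open>X\<close> is made for: it is the part of \<open>A B C\<close> that \<open>a (r/c)\<close> does not already supply.\<close>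

lemma X_of_dvd_iff:
  assumes "a > 0" "b > 0"
  shows "X_of n r a b c dvd x \<longleftrightarrow>
    A_of n a b * B_of r b c * C_of r a c dvd a * (r div c) * x"
proof -
  have "A_of n a b * B_of r b c * C_of r a c \<noteq> 0"
    using assms by (simp add: A_of_def B_of_def C_of_def)
  from dvd_mult_iff_div_gcd_dvd[OF this] show ?thesis
    by (simp add: X_of_def Let_def gcd.commute)
qed

text \<open>Multiplying \<open>C dvd (q/B) y (a/A) t\<close>, where \<open>q = r/c\<close>, by \<open>A B\<close> clears the quotients and leaves
the condition that characterises \<open>X\<close>.\<close>

lemma solvable_iff_X_dvd:
  assumes pos: "a > 0" "b > 0"
    and v: "v = b div B_of r b c * y" and s: "s = a div A_of n a b * t"
  shows "C_of r a c dvd (r div c) * v div b * s \<longleftrightarrow> X_of n r a b c dvd y * t"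
proof -
  define A B C q where "A = A_of n a b" and "B = B_of r b c" and "C = C_of r a c" and "q = r div c"
  have "A > 0" "B > 0" using pos by (simp_all add: A_def B_def A_of_def B_of_def)
  have "A dvd a" "B dvd b" "B dvd q" by (simp_all add: A_def B_def q_def A_of_def B_of_def)
  then obtain a' b' q' where a: "a = A * a'" and b: "b = B * b'" and q: "q = B * q'"
    by (auto elim!: dvdE)
  have v': "v = b' * y" and s': "s = a' * t"
  proof -
    have "b div B = b'" "a div A = a'" using \<open>A > 0\<close> \<open>B > 0\<close> by (simp_all add: a b)
    thus "v = b' * y" "s = a' * t" using v s by (simp_all add: A_def B_def)
  qed
  have "q * v = b * (q' * y)" by (simp add: q v' b)
  hence "q * v div b = q' * y" using pos by simp
  hence "C dvd q * v div b * s \<longleftrightarrow> C dvd q' * y * (a' * t)" by (simp add: s')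
  also have "\<dots> \<longleftrightarrow> (A * B) * C dvd (A * B) * (q' * y * (a' * t))"
    using \<open>A > 0\<close> \<open>B > 0\<close> by simp
  also have "(A * B) * (q' * y * (a' * t)) = a * q * (y * t)"
    by (simp only: a q ac_simps)
  also have "(A * B) * C dvd a * q * (y * t) \<longleftrightarrow> X_of n r a b c dvd y * t"
    by (simp only: X_of_dvd_iff[OF pos] A_def B_def C_def q_def)
  finally show ?thesis by (simp add: C_def q_def)
qed

lemma s_of_eq: "s_of n a b t = a div A_of n a b * t"
  by (simp add: s_of_def A_of_def dvd_div_mult)

lemma s_of_range_iff:
  assumes "a > 0"
  shows "s < a \<and> a dvd (n div b) * s \<longleftrightarrow> (\<exists>t < A_of n a b. s = s_of n a b t)"
  using reduced_annihilator_iff[OF assms] by (simp add: s_of_eq A_of_def)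

lemma v_of_eq:
  assumes "a > 0" "b > 0"
  shows "v_of n r a b c t w =
    b div B_of r b c * (X_of n r a b c div gcd (X_of n r a b c) t * w)"
proof -
  define B X g where "B = B_of r b c" and "X = X_of n r a b c" and "g = gcd X t"
  have "B dvd b" "g dvd X" by (simp_all add: B_def B_of_def g_def)
  hence "b * X div (B * g) = (b div B) * (X div g)" by (rule div_mult_div_if_dvd[symmetric])
  thus ?thesis by (simp add: v_of_def B_def X_def g_def gcd.commute)
qed

text \<open>Among the \<open>v = (b/B) y\<close> with \<open>y < B\<close>, solvability selects those with \<open>X dvd t y\<close>, that is, with
\<open>y\<close> a multiple of \<open>h = X / gcd X t\<close>. Since \<open>h dvd B\<close>, there are \<open>B / h\<close> of them.\<close>

lemma v_of_range_iff:
  assumes pos: "a > 0" "b > 0" and s: "s = s_of n a b t"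
  shows "v < b \<and> b dvd (r div c) * v \<and> C_of r a c dvd (r div c) * v div b * s \<longleftrightarrow>
    (\<exists>w < B_of r b c * gcd t (X_of n r a b c) div X_of n r a b c. v = v_of n r a b c t w)"
proof -
  define B X g where "B = B_of r b c" and "X = X_of n r a b c" and "g = gcd X t"
  have "X dvd B" using X_dvd_B[OF pos] by (simp add: B_def X_def)
  moreover have "B > 0" using pos by (simp add: B_def B_of_def)
  ultimately have "X > 0" by (auto intro: Nat.gr0I)
  hence "g > 0" by (simp add: g_def)
  define h where "h = X div g"
  have X: "X = h * g" by (simp add: h_def g_def)
  have "h > 0" using \<open>X > 0\<close> X by (auto intro: Nat.gr0I)
  have "h dvd B" using \<open>X dvd B\<close> X by (metis dvd_mult_left)
  have bound: "B div h = B * gcd t X div X"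
  proof -
    have "B * gcd t X = g * B" by (simp add: g_def gcd.commute)
    also have "\<dots> div X = B div h" using \<open>g > 0\<close> by (simp add: X mult.commute[of h])
    finally show ?thesis by simp
  qed
  have "v < b \<and> b dvd (r div c) * v \<and> C_of r a c dvd (r div c) * v div b * s \<longleftrightarrow>
      (\<exists>y < B. v = b div B * y \<and> C_of r a c dvd (r div c) * v div b * s)"
    using reduced_annihilator_iff[OF pos(2), of v "r div c"] by (auto simp: B_def B_of_def)
  also have "\<dots> \<longleftrightarrow> (\<exists>y < B. v = b div B * y \<and> X dvd t * y)"
    using solvable_iff_X_dvd[OF pos _ s[unfolded s_of_eq], of v r c]
    by (auto simp: B_def X_def mult.commute)
  also have "\<dots> \<longleftrightarrow> (\<exists>y < B. v = b div B * y \<and> h dvd y)"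
    using \<open>X > 0\<close> by (simp add: dvd_mult_iff_div_gcd_dvd h_def g_def)
  also have "\<dots> \<longleftrightarrow> (\<exists>w < B div h. v = b div B * (h * w))"
  proof -
    have "(\<exists>y < B. v = b div B * y \<and> h dvd y) \<longleftrightarrow> (\<exists>y. v = b div B * y \<and> (y < B \<and> h dvd y))" by metis
    also have "\<dots> \<longleftrightarrow> (\<exists>w < B div h. v = b div B * (h * w))"
      unfolding less_and_dvd_iff[OF \<open>h dvd B\<close> \<open>h > 0\<close>] by auto
    finally show ?thesis .
  qed
  also have "\<dots> \<longleftrightarrow> (\<exists>w < B * gcd t X div X. v = v_of n r a b c t w)"
    unfolding bound v_of_eq[OF pos] by (simp add: B_def X_def h_def g_def)
  finally show ?thesis by (simp add: B_def X_def)
qed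

lemma s_of_inj:
  assumes "a > 0" "s_of n a b t = s_of n a b t'"
  shows "t = t'"
proof -
  have "a div A_of n a b > 0"
    using assms by (simp add: A_of_def div_greater_zero_iff)
  thus ?thesis using assms by (simp add: s_of_eq)
qed

lemma v_of_inj:
  assumes pos: "a > 0" "b > 0" and eq: "v_of n r a b c t w = v_of n r a b c t w'"
  shows "w = w'"
proof -
  have "X_of n r a b c > 0"
    using X_dvd_B[OF pos, of n r c] pos by (auto simp: B_of_def intro!: Nat.gr0I)
  hence "X_of n r a b c div gcd (X_of n r a b c) t > 0"
    by (simp add: div_greater_zero_iff dvd_imp_le)
  moreover have "b div B_of r b c > 0"
    using pos by (simp add: B_of_def div_greater_zero_iff)
  ultimately show ?thesis using eq by (simp add: v_of_eq[OF pos])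
qed

text \<open>The right-hand side \<open>r v s / (b c)\<close> of the congruence for \<open>u\<close> is the one that the period
\<open>(0, 0, r)\<close> imposes.\<close>

lemma congruence_rhs_eq:
  fixes b c r s v :: nat
  assumes "b > 0" "c > 0" "c dvd r" and dvd: "b dvd (r div c) * v"
  shows "r * v * s div (b * c) = (r div c) * v div b * s"
proof -
  obtain q where q: "r = c * q" using assms by (auto elim: dvdE)
  hence "r div c = q" using assms(2) by simp
  then obtain f where f: "q * v = b * f" using dvd by (auto elim: dvdE)
  have "r * v * s = c * (q * v) * s" by (simp add: q)
  also have "\<dots> = (b * c) * (f * s)" by (simp only: f ac_simps)
  finally have eq: "r * v * s = (b * c) * (f * s)" .
  have "r * v * s div (b * c) = f * s" unfolding eq using assms(1,2) by simp
  moreover have "(r div c) * v div b = f" using f \<open>r div c = q\<close> assms(1) by simp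
  ultimately show ?thesis by simp
qed

lemma quintuplesD:
  assumes "(a, b, c, t, w) \<in> quintuples m n r"
  shows "a > 0" "b > 0" "c > 0" "a dvd m" "b dvd n" "c dvd r" "t < A_of n a b"
    "w < B_of r b c * gcd t (X_of n r a b c) div X_of n r a b c"
  using assms by (auto simp: quintuples_def)

lemma quintuple_normal_form:
  assumes "(a, b, c, t, w) \<in> quintuples m n r"
  shows "solves n r a b c t w u \<longleftrightarrow>
    contains_periods m n r (hermite_lattice a b c (s_of n a b t) (v_of n r a b c t w) u)"
    "s_of n a b t < a" "v_of n r a b c t w < b"
    "C_of r a c dvd (r div c) * v_of n r a b c t w div b * s_of n a b t"
    "b dvd (r div c) * v_of n r a b c t w"
proof -
  note q = quintuplesD[OF assms]
  define s v where "s = s_of n a b t" and "v = v_of n r a b c t w"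
  have s: "s < a \<and> a dvd (n div b) * s"
    using s_of_range_iff[OF q(1)] q(7) by (auto simp: s_def)
  have v: "v < b \<and> b dvd (r div c) * v \<and> C_of r a c dvd (r div c) * v div b * s"
    using v_of_range_iff[OF q(1,2) s_def] q(8) by (auto simp: v_def)
  show "s_of n a b t < a" "v_of n r a b c t w < b"
    "C_of r a c dvd (r div c) * v_of n r a b c t w div b * s_of n a b t"
    "b dvd (r div c) * v_of n r a b c t w"
    using s v by (simp_all add: s_def v_def)
  show "solves n r a b c t w u \<longleftrightarrow>
    contains_periods m n r (hermite_lattice a b c (s_of n a b t) (v_of n r a b c t w) u)"
    unfolding solves_def contains_periods_hermite_lattice_iff[OF q(1,2,3)]
      s_def[symmetric] v_def[symmetric]
    using q s v congruence_rhs_eq[OF q(2,3,6), of v s] by simp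
qed

text \<open>The congruence for \<open>u\<close> has a solution, namely the given one, so \<open>C\<close> divides its right-hand side
and \<open>v_of_range_iff\<close> applies.\<close>

lemma quintuple_of_normal_form:
  assumes pos: "a > 0" "b > 0" "c > 0" and reduced: "s < a" "v < b"
    and per: "contains_periods m n r (hermite_lattice a b c s v u)"
  obtains t w where "(a, b, c, t, w) \<in> quintuples m n r" "s = s_of n a b t" "v = v_of n r a b c t w"
proof -
  note per' = per[unfolded contains_periods_hermite_lattice_iff[OF pos]]
  obtain t where t: "t < A_of n a b" "s = s_of n a b t"
    using s_of_range_iff[OF pos(1), of s n b] reduced per' by blast
  have "int (C_of r a c) dvd int (r div c) * u - int ((r div c) * v div b * s)"
    using per' by (auto simp: cong_iff_dvd_diff C_of_def intro: dvd_trans[of "int (gcd a (r div c))" "int a"])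
  moreover have "int (C_of r a c) dvd int (r div c) * u" by (simp add: C_of_def)
  ultimately have "int (C_of r a c) dvd int ((r div c) * v div b * s)"
    by (metis dvd_diff_right_iff)
  hence "C_of r a c dvd (r div c) * v div b * s" using int_dvd_int_iff by blast
  then obtain w where "w < B_of r b c * gcd t (X_of n r a b c) div X_of n r a b c"
    "v = v_of n r a b c t w"
    using v_of_range_iff[OF pos(1,2) t(2)] reduced per' by blast
  thus ?thesis using that[of t w] t pos per' by (simp add: quintuples_def)
qed

lemma solution_exists:
  assumes "(a, b, c, t, w) \<in> quintuples m n r"
  shows "\<exists>u. solves n r a b c t w u"
proof -
  note q = quintuplesD[OF assms]
  have "gcd (int (r div c)) (int a) dvd int ((r div c) * v_of n r a b c t w div b * s_of n a b t)"
    using quintuple_normal_form(4)[OF assms] unfolding C_of_def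
    by (metis gcd.commute gcd_int_int_eq int_dvd_int_iff)
  from cong_solve_dvd_int[OF this] show ?thesis
    unfolding solves_def congruence_rhs_eq[OF q(2,3,6) quintuple_normal_form(5)[OF assms]] .
qed

lemma u_of_eq: "u_of r u0 a b c t w z = u0 a b c t w + int (a div C_of r a c * z)"
  by (simp add: u_of_def C_of_def dvd_div_mult)

lemma solves_iff_u_of:
  assumes "a > 0" "solves n r a b c t w (u0 a b c t w)"
  shows "solves n r a b c t w u \<longleftrightarrow> (\<exists>z < C_of r a c. [u = u_of r u0 a b c t w z] (mod int a))"
  using congruence_solutions_iff[OF assms(1) assms(2)[unfolded solves_def]]
  unfolding solves_def u_of_eq C_of_def .

lemma u_of_inj_mod:
  assumes "a > 0" "z < C_of r a c" "z' < C_of r a c"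
    and "[u_of r u0 a b c t w z = u_of r u0 a b c t w z'] (mod int a)"
  shows "z = z'"
proof -
  define e where "e = a div C_of r a c"
  have a: "a = C_of r a c * e" by (simp add: e_def C_of_def)
  hence "e > 0" using assms(1) by (metis gr0I mult_0_right less_not_refl)
  have "[int (e * z) = int (e * z')] (mod int a)"
    using assms(4) unfolding u_of_eq e_def[symmetric] by (simp add: cong_add_lcancel)
  hence "[e * z = e * z'] (mod a)" by (simp only: cong_int_iff)
  moreover have "e * z < a" "e * z' < a" using assms(2,3) \<open>e > 0\<close> a
    by (metis mult.commute mult_less_cancel1)+
  ultimately show ?thesis using \<open>e > 0\<close> by (simp add: cong_def)
qed

section \<open>The bijection\<close>

lemma U_sub_eq:
  assumes "m > 0" "n > 0" "r > 0"
  shows "U_sub m n r u0 a b c t w z = res m n r `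
    hermite_lattice a b c (s_of n a b t) (v_of n r a b c t w) (u_of r u0 a b c t w z)"
  unfolding U_sub_def by (rule generate_eq_res_hermite_lattice[OF assms])

lemma periods_of_sextuple:
  assumes "solution_choice m n r u0" "(a, b, c, t, w, z) \<in> sextuples m n r"
  shows "(a, b, c, t, w) \<in> quintuples m n r" "z < C_of r a c"
    "contains_periods m n r
      (hermite_lattice a b c (s_of n a b t) (v_of n r a b c t w) (u_of r u0 a b c t w z))"
proof -
  show q: "(a, b, c, t, w) \<in> quintuples m n r" and z: "z < C_of r a c"
    using assms(2) by (auto simp: sextuples_def)
  have "solves n r a b c t w (u0 a b c t w)"
    using assms(1) q unfolding solution_choice_def by fast
  hence "solves n r a b c t w (u_of r u0 a b c t w z)"
    using solves_iff_u_of[OF quintuplesD(1)[OF q], where ?u0.0 = u0 and t = t and w = w] z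
    by auto
  thus "contains_periods m n r
      (hermite_lattice a b c (s_of n a b t) (v_of n r a b c t w) (u_of r u0 a b c t w z))"
    using quintuple_normal_form(1)[OF q] by blast
qed

lemma U_sub_properties:
  assumes pos: "m > 0" "n > 0" "r > 0"
    and u0: "solution_choice m n r u0" and sx: "(a, b, c, t, w, z) \<in> sextuples m n r"
  shows "U_sub m n r u0 a b c t w z = U_elems m n r u0 a b c t w z"
    "subgroup (U_sub m n r u0 a b c t w z) (Gam m n r)"
    "card (U_sub m n r u0 a b c t w z) = m * n * r div (a * b * c)"
proof -
  note p = periods_of_sextuple[OF u0 sx]
  note box = res_hermite_lattice_box[OF quintuplesD(1,2,3)[OF p(1)] pos p(3)]
  show "U_sub m n r u0 a b c t w z = U_elems m n r u0 a b c t w z"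
    unfolding U_sub_eq[OF pos] box(1) U_elems_def ..
  show "card (U_sub m n r u0 a b c t w z) = m * n * r div (a * b * c)"
    unfolding U_sub_eq[OF pos] box(2) ..
  show "subgroup (U_sub m n r u0 a b c t w z) (Gam m n r)"
    unfolding U_sub_eq[OF pos] by (intro subgroup_res_image add_subgroup_hermite_lattice pos)
qed

text \<open>Equal subgroups have equal preimages in \<open>\<int>\<^sup>3\<close>, hence the same normal form. The parameters are
then recovered in the order \<open>a, b, c, t, w, z\<close>; in particular \<open>z\<close> comes last because the fixed
solution \<open>u0\<close> depends on the other five.\<close>

lemma U_sub_inj:
  assumes pos: "m > 0" "n > 0" "r > 0" and u0: "solution_choice m n r u0"
    and sx: "(a, b, c, t, w, z) \<in> sextuples m n r" "(a', b', c', t', w', z') \<in> sextuples m n r"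
    and eq: "U_sub m n r u0 a b c t w z = U_sub m n r u0 a' b' c' t' w' z'"
  shows "(a, b, c, t, w, z) = (a', b', c', t', w', z')"
proof -
  note p = periods_of_sextuple[OF u0 sx(1)] and p' = periods_of_sextuple[OF u0 sx(2)]
  note q = quintuplesD[OF p(1)] and q' = quintuplesD[OF p'(1)]
  let ?L = "hermite_lattice a b c (s_of n a b t) (v_of n r a b c t w) (u_of r u0 a b c t w z)"
  let ?L' = "hermite_lattice a' b' c' (s_of n a' b' t') (v_of n r a' b' c' t' w') (u_of r u0 a' b' c' t' w' z')"
  have "res m n r -` (res m n r ` ?L) = res m n r -` (res m n r ` ?L')"
    using eq unfolding U_sub_eq[OF pos] by simp
  hence "?L = ?L'"
    unfolding res_preimage_image[OF add_subgroup_hermite_lattice p(3)]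
      res_preimage_image[OF add_subgroup_hermite_lattice p'(3)] .
  note uniq = hermite_lattice_unique[OF this q(1,2,3) q'(1,2,3)
      quintuple_normal_form(2)[OF p(1)] quintuple_normal_form(2)[OF p'(1)]
      quintuple_normal_form(3)[OF p(1)] quintuple_normal_form(3)[OF p'(1)]]
  have abc: "a' = a" "b' = b" "c' = c" using uniq(1-3) by simp_all
  have t: "t' = t" using uniq(4) s_of_inj[OF q(1)] unfolding abc by metis
  have w: "w' = w" using uniq(5) v_of_inj[OF q(1,2)] unfolding abc t by metis
  have "z = z'"
    using u_of_inj_mod[OF q(1) p(2)] p'(2) uniq(6) unfolding abc t w by blast
  thus ?thesis by (simp add: abc t w)
qed

lemma U_sub_surj:
  assumes pos: "m > 0" "n > 0" "r > 0" and u0: "solution_choice m n r u0"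
    and H: "subgroup H (Gam m n r)"
  obtains a b c t w z where "(a, b, c, t, w, z) \<in> sextuples m n r"
    "H = U_sub m n r u0 a b c t w z"
proof -
  note pre = res_preimage_of_subgroup[OF H pos]
  obtain a b c s v u where nf: "a > 0" "b > 0" "c > 0" "s < a" "v < b"
    "res m n r -` H = hermite_lattice a b c s v u"
    by (rule hermite_normal_form_exists[OF pre(1,2) pos])
  have per: "contains_periods m n r (hermite_lattice a b c s v u)" using pre(2) nf(6) by simp
  obtain t w where tw: "(a, b, c, t, w) \<in> quintuples m n r" "s = s_of n a b t"
    "v = v_of n r a b c t w"
    by (rule quintuple_of_normal_form[OF nf(1-5) per])
  have "solves n r a b c t w (u0 a b c t w)"
    using u0 tw(1) unfolding solution_choice_def by fast
  moreover have "solves n r a b c t w u"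
    using per unfolding quintuple_normal_form(1)[OF tw(1)] tw .
  ultimately obtain z where z: "z < C_of r a c" "[u = u_of r u0 a b c t w z] (mod int a)"
    using solves_iff_u_of[OF nf(1)] by blast
  have "H = res m n r ` (res m n r -` H)" using pre(3) by simp
  also have "\<dots> = U_sub m n r u0 a b c t w z"
    unfolding nf(6) U_sub_eq[OF pos] hermite_lattice_cong[OF z(2)] tw ..
  finally have "H = U_sub m n r u0 a b c t w z" .
  moreover have "(a, b, c, t, w, z) \<in> sextuples m n r"
    using tw(1) z(1) by (simp add: sextuples_def)
  ultimately show ?thesis using that by blast
qed

theorem theorem2p1:
  fixes m n r :: nat
  assumes "m > 0" and "n > 0" and "r > 0"
  shows "(\<forall>(a, b, c, t, w) \<in> quintuples m n r. \<exists>u. solves n r a b c t w u) \<and>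
    (\<forall>u0. solution_choice m n r u0 \<longrightarrow>
       (\<forall>(a, b, c, t, w, z) \<in> sextuples m n r.
          U_sub m n r u0 a b c t w z = U_elems m n r u0 a b c t w z \<and>
          subgroup (U_sub m n r u0 a b c t w z) (Gam m n r) \<and>
          card (U_sub m n r u0 a b c t w z) = m * n * r div (a * b * c)) \<and>
       bij_betw (\<lambda>(a, b, c, t, w, z). U_sub m n r u0 a b c t w z)
         (sextuples m n r) {H. subgroup H (Gam m n r)})"
proof (intro conjI allI impI)
  show "\<forall>(a, b, c, t, w) \<in> quintuples m n r. \<exists>u. solves n r a b c t w u"
    using solution_exists by blast
next
  fix u0 assume u0: "solution_choice m n r u0"
  show "\<forall>(a, b, c, t, w, z) \<in> sextuples m n r.
          U_sub m n r u0 a b c t w z = U_elems m n r u0 a b c t w z \<and>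
          subgroup (U_sub m n r u0 a b c t w z) (Gam m n r) \<and>
          card (U_sub m n r u0 a b c t w z) = m * n * r div (a * b * c)"
    using U_sub_properties[OF assms u0] by blast
  show "bij_betw (\<lambda>(a, b, c, t, w, z). U_sub m n r u0 a b c t w z)
         (sextuples m n r) {H. subgroup H (Gam m n r)}" (is "bij_betw ?U _ _")
  proof (rule bij_betw_imageI)
    show "inj_on ?U (sextuples m n r)"
    proof (rule inj_onI)
      fix p p' assume mem: "p \<in> sextuples m n r" "p' \<in> sextuples m n r" and eq: "?U p = ?U p'"
      obtain a b c t w z where p: "p = (a, b, c, t, w, z)" by (rule prod_cases6)
      obtain a' b' c' t' w' z' where p': "p' = (a', b', c', t', w', z')" by (rule prod_cases6)
      show "p = p'"
        using U_sub_inj[OF assms u0] mem eq unfolding p p' prod.case by blast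
    qed
    show "?U ` sextuples m n r = {H. subgroup H (Gam m n r)}"
    proof (intro equalityI subsetI)
      fix H assume "H \<in> ?U ` sextuples m n r"
      then obtain p where p: "p \<in> sextuples m n r" "H = ?U p" by blast
      obtain a b c t w z where abc: "p = (a, b, c, t, w, z)" by (rule prod_cases6)
      show "H \<in> {H. subgroup H (Gam m n r)}"
        using U_sub_properties(2)[OF assms u0] p unfolding abc by simp
    next
      fix H assume "H \<in> {H. subgroup H (Gam m n r)}"
      hence "subgroup H (Gam m n r)" by simp
      then obtain a b c t w z where p: "(a, b, c, t, w, z) \<in> sextuples m n r"
        and H: "H = U_sub m n r u0 a b c t w z" by (rule U_sub_surj[OF assms u0])
      show "H \<in> ?U ` sextuples m n r"
        by (rule image_eqI[OF _ p]) (simp add: H)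
    qed
  qed
qed

end
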